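(* Let $G$ be a graph obtained from a (finite) complete graph by removing the edges of a matching. Then $G$ has a $2$-dot product representation.
   Context: Graphs are finite and simple. For an integer $d\ge 1$, a $d$-dot product representation of a graph $G=(V,E)$ is an assignment of a vector $\mathbf{a}^u\in\mathbb{R}^d$ to each vertex $u\in V$ together with a threshold $t>0$ such that, for all distinct $u,v\in V$, $uv\in E$ if and only if $\mathbf{a}^u\cdot\mathbf{a}^v\ge t$ (standard dot product; one may take $t=1$ by scaling). *)

theory Defs
  imports "HOL-Analysis.Analysis"
begin

text \<open>A finite simple graph is given by its vertex set \<open>V\<close> and its edge set \<open>E\<close>, an edge
  being an unordered pair of distinct vertices.\<close>

definition simple_graph :: "'v set \<Rightarrow> 'v set set \<Rightarrow> bool" where
  "simple_graph V E \<longleftrightarrow> finite V \<and> (\<forall>e\<in>E. e \<subseteq> V \<and> card e = 2)"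

definition complete_graph :: "'v set \<Rightarrow> 'v set set \<Rightarrow> bool" where
  "complete_graph V E \<longleftrightarrow>
     simple_graph V E \<and> (\<forall>u\<in>V. \<forall>v\<in>V. u \<noteq> v \<longrightarrow> {u, v} \<in> E)"

text \<open>Matchings need be neither perfect nor maximal; the empty matching is allowed.\<close>

definition matching :: "'v set set \<Rightarrow> 'v set set \<Rightarrow> bool" where
  "matching E M \<longleftrightarrow> M \<subseteq> E \<and> pairwise disjnt M"

text \<open>The dimension of the representation is the cardinality of the index type \<open>'d\<close>.\<close>

definition dot_product_rep ::
    "'v set \<Rightarrow> 'v set set \<Rightarrow> ('v \<Rightarrow> real ^ 'd) \<Rightarrow> real \<Rightarrow> bool" where
  "dot_product_rep V E a t \<longleftrightarrow>
     t > 0 \<and> (\<forall>u\<in>V. \<forall>v\<in>V. u \<noteq> v \<longrightarrow> ({u, v} \<in> E \<longleftrightarrow> a u \<bullet> a v \<ge> t))"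

end

theory Submission
  imports Defs
begin

text \<open>On the hyperbola \<open>xy = 1\<close>, parametrised by \<open>(exp c, exp (- c))\<close>, two points satisfy
  \<open>p c \<bullet> p d = 2 cosh (c + d)\<close>, which is at least \<open>2\<close>, with equality exactly when \<open>c + d = 0\<close>.
  So it suffices to label the vertices by reals such that the labels of two distinct vertices are
  opposite exactly when the vertices are matched, and to take the threshold slightly above \<open>2\<close>.\<close>

definition hyperbola_point :: "real \<Rightarrow> real ^ 2" where
  "hyperbola_point c = vector [exp c, exp (- c)]"

lemma inner_hyperbola_point:
  "hyperbola_point c \<bullet> hyperbola_point d = 2 * cosh (c + d)"
  by (simp add: hyperbola_point_def inner_vec_def sum_2 cosh_def exp_add exp_diff
      exp_minus divide_simps)

text \<open>Group the vertices into blocks, each the two ends of an edge of \<open>M\<close> or a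
  single unmatched vertex. Every block gets its own absolute value and the two ends of an edge get
  opposite signs, so labels of distinct vertices cancel only within a block.\<close>

lemma matching_opposite_labels:
  assumes "finite V" and "matching K M" and M2: "\<And>e. e \<in> M \<Longrightarrow> card e = 2"
  obtains c :: "'v \<Rightarrow> real" where
    "\<And>u v. u \<in> V \<Longrightarrow> v \<in> V \<Longrightarrow> u \<noteq> v \<Longrightarrow> c u + c v = 0 \<longleftrightarrow> {u, v} \<in> M"
proof -
  \<comment> \<open>The block of \<open>v\<close>: the edge of \<open>M\<close> at \<open>v\<close>
    if there is one, otherwise \<open>{v}\<close>.\<close>
  define B where "B v = insert v (\<Union>{e\<in>M. v \<in> e})" for v
  have edge_unique: "e = e'" if "e \<in> M" "e' \<in> M" "v \<in> e" "v \<in> e'" for e e' v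
    using assms(2) that by (auto simp: matching_def pairwise_def disjnt_def)
  have B_edge: "B u = {u, v}" "B v = {u, v}" if "{u, v} \<in> M" for u v
  proof -
    have "{e\<in>M. u \<in> e} = {{u, v}}" "{e\<in>M. v \<in> e} = {{u, v}}"
      using that edge_unique by blast+
    then show "B u = {u, v}" "B v = {u, v}"
      by (auto simp: B_def)
  qed
  have B_eq: "{u, v} \<in> M" if "B u = B v" "u \<noteq> v" for u v
  proof -
    have "v \<in> B u"
      using that by (simp add: B_def)
    then obtain e where e: "e \<in> M" "u \<in> e" "v \<in> e"
      using \<open>u \<noteq> v\<close> unfolding B_def by blast
    then have "e = {u, v}"
      using M2[of e] \<open>u \<noteq> v\<close> by (auto simp: card_2_iff)
    with e show ?thesis by simp
  qed
  obtain l :: "'v set \<Rightarrow> nat" where l: "inj_on l (B ` V)"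
    using finite_imp_inj_to_nat_seg[of "B ` V"] \<open>finite V\<close> by blast
  \<comment> \<open>The choice depends only on the set \<open>B v\<close>, so both ends of an edge
    see the same chosen vertex and exactly one of them gets the positive sign.\<close>
  define c :: "'v \<Rightarrow> real" where
    "c v = (if v = (SOME x. x \<in> B v) then 1 else - 1) * (1 + real (l (B v)))" for v
  have "c u + c v = 0 \<longleftrightarrow> {u, v} \<in> M" if "u \<in> V" "v \<in> V" "u \<noteq> v" for u v
  proof
    assume "c u + c v = 0"
    then have "l (B u) = l (B v)"
      by (auto simp: c_def split: if_splits)
    then have "B u = B v"
      using l that by (auto dest: inj_onD)
    then show "{u, v} \<in> M"
      using B_eq \<open>u \<noteq> v\<close> by blast
  next
    assume "{u, v} \<in> M"
    moreover have "(SOME x. x \<in> {u, v}) \<in> {u, v}"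
      by (rule someI[of _ u]) simp
    ultimately show "c u + c v = 0"
      using \<open>u \<noteq> v\<close> unfolding c_def by (simp only: B_edge) auto
  qed
  then show thesis by (rule that)
qed

theorem theorem8:
  fixes V :: "'v set" and K M :: "'v set set"
  assumes "complete_graph V K"
    and "matching K M"
  shows "\<exists>(a :: 'v \<Rightarrow> real ^ 2) t. dot_product_rep V (K - M) a t"
proof -
  have fin: "finite V" and K: "\<And>u v. u \<in> V \<Longrightarrow> v \<in> V \<Longrightarrow> u \<noteq> v \<Longrightarrow> {u, v} \<in> K"
    and M2: "\<And>e. e \<in> M \<Longrightarrow> card e = 2"
    using assms by (auto simp: complete_graph_def simple_graph_def matching_def)
  obtain c :: "'v \<Rightarrow> real" where
    c: "\<And>u v. u \<in> V \<Longrightarrow> v \<in> V \<Longrightarrow> u \<noteq> v \<Longrightarrow> c u + c v = 0 \<longleftrightarrow> {u, v} \<in> M"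
    using matching_opposite_labels[OF fin assms(2) M2] by blast
  define a where "a v = hyperbola_point (c v)" for v
  \<comment> \<open>Only finitely many dot products occur, so \<open>t\<close> can lie strictly
    above 2 and still not exceed any of those above 2. The \<open>3\<close> gives \<open>Min\<close>
    a nonempty set even if \<open>S\<close> is empty; any number above 2 would serve.\<close>
  define S where "S = {r \<in> (\<lambda>(u, v). a u \<bullet> a v) ` (V \<times> V). r > 2}"
  define t where "t = Min (insert 3 S)"
  have "finite S"
    using fin by (simp add: S_def)
  then have t2: "t > 2" and t_le: "\<And>r. r \<in> S \<Longrightarrow> t \<le> r"
    by (auto simp: t_def S_def)
  have "{u, v} \<in> K - M \<longleftrightarrow> t \<le> a u \<bullet> a v" if uv: "u \<in> V" "v \<in> V" "u \<noteq> v" for u v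
  proof (cases "{u, v} \<in> M")
    case True
    then have "a u \<bullet> a v = 2"
      using c[OF uv] by (simp add: a_def inner_hyperbola_point)
    with True t2 show ?thesis by simp
  next
    case False
    then have "a u \<bullet> a v > 2"
      using c[OF uv] cosh_real_ge_1[of "c u + c v"] cosh_real_one_iff[of "c u + c v"]
      unfolding a_def inner_hyperbola_point by linarith
    then have "t \<le> a u \<bullet> a v"
      using uv by (intro t_le) (auto simp: S_def)
    with False K[OF uv] show ?thesis by simp
  qed
  with t2 have "dot_product_rep V (K - M) a t"
    by (simp add: dot_product_rep_def)
  then show ?thesis by blast
qed

end
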